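(* For every real $q$ with $0<q<1$, $$\frac{(q^{2/3};q)_\infty(q^{5/3};q)_\infty(q^{1/6};q)_\infty}{(q;q)_\infty^2\,(q^{1/2};q)_\infty} =\sum_{n=0}^{\infty}(-1)^n\frac{(q^{1/6},q^{1/6},q^{1/3};q^{1/2})_n\,(q^{5/3};q)_n(q^{5/6};q)_n}{(q;q)_n^2\,(q^{1/2};q^{1/2})_{3n}\,(1+q^{\frac n2+\frac13}+q^{n+\frac23})}$$ $$\times q^{\frac{9n^2+5n+4}{12}}\left\{\frac{1-q^{n-\frac16}}{1-q^{\frac n2+\frac13}}+\frac{q^{-\frac n2-\frac13}(1-q^{2n+\frac23})^2}{(1-q^{n+\frac23})(1-q^{\frac{3n}2+\frac12})}\right\}.$$
   Context: For a base $p$: $(x;p)_0=1$, $(x;p)_n=\prod_{j=0}^{n-1}(1-p^jx)$, $(x;p)_\infty=\prod_{j\ge0}(1-p^jx)$, and $(x_1,\dots,x_r;p)_n=(x_1;p)_n\cdots(x_r;p)_n$. Fractional powers of $q$ are the positive real ones. *)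

theory Defs
  imports "HOL-Analysis.Analysis"
begin

definition qpoch :: "real \<Rightarrow> real \<Rightarrow> nat \<Rightarrow> real" where
  "qpoch x p n = (\<Prod>j<n. 1 - p ^ j * x)"

(* (x_1, ..., x_r; p)_n *)
definition qpochs :: "real list \<Rightarrow> real \<Rightarrow> nat \<Rightarrow> real" where
  "qpochs xs p n = (\<Prod>x\<leftarrow>xs. qpoch x p n)"

(* Only meaningful where the product converges, e.g. for \<bar>p\<bar> < 1. *)
definition qpoch_inf :: "real \<Rightarrow> real \<Rightarrow> real" where
  "qpoch_inf x p = (\<Prod>j. 1 - p ^ j * x)"

end

(* Put t = q^(1/6) and p = t^3. Let S(x, y, z) be the sum over k of
     (1 - a p^(3k)) (x, y, z; p)_k (d; p^2)_k / ((p y z, p x z, p x y; p^2)_k (a p/d; p)_k) (a/d)^k p^(k(k+1)/2),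
   where a = x y z / p. Two contiguous relations, each certified by a telescoping term:
   (1) S(x, y, z) = alpha + beta S(p x, p y, p z). Iterating it expands S(x, y, z) into a rapidly
       convergent series; for x = y = d = t, z = t^2 this is the series of the theorem times 1 - t^4.
   (2) If y z = p, so that x = a, then S(a, y, z) = beta' S(p^2 a, y, z). Iterating it, a tends to 0 and
       S to 1, so S(a, y, z) is an infinite product. The point x = y = d = t, z = t^2 satisfies y z = p,
       and there the product is the left-hand side of the theorem times 1 - t^4. *)
theory Submission
  imports Defs
begin

section \<open>q-shifted factorials: shifts, bounds and infinite products\<close>

lemma qpoch_0 [simp]: "qpoch x p 0 = 1"
  by (simp add: qpoch_def)

lemma qpoch_Suc: "qpoch x p (Suc n) = qpoch x p n * (1 - p ^ n * x)"
  by (simp add: qpoch_def)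

text \<open>Both sides are \<open>qpoch x p (Suc n)\<close>, with the first or the last factor split
  off. The cross-multiplied form also covers \<open>x = 1\<close> and passes to the limit in
  \<open>n\<close>.\<close>

lemma qpoch_shift: "(1 - x) * qpoch (p * x) p n = qpoch x p n * (1 - p ^ n * x)"
proof -
  have "qpoch x p (Suc n) = (1 - x) * qpoch (p * x) p n"
    unfolding qpoch_def by (subst prod.lessThan_Suc_shift) (simp add: mult_ac)
  thus ?thesis
    by (simp add: qpoch_Suc)
qed

lemma qpoch_shift2:
  "(1 - x) * (1 - p * x) * qpoch (p\<^sup>2 * x) p n
     = qpoch x p n * ((1 - p ^ n * x) * (1 - p ^ n * (p * x)))"
proof -
  have "(1 - x) * ((1 - p * x) * qpoch (p * (p * x)) p n)
      = (1 - x) * qpoch (p * x) p n * (1 - p ^ n * (p * x))"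
    by (subst qpoch_shift) simp
  also have "\<dots> = qpoch x p n * (1 - p ^ n * x) * (1 - p ^ n * (p * x))"
    by (simp only: qpoch_shift)
  finally show ?thesis
    by (simp add: power2_eq_square mult_ac)
qed

lemma qpoch_nonneg_le_1:
  assumes "0 \<le> x" "x \<le> 1" "0 \<le> p" "p \<le> 1"
  shows "0 \<le> qpoch x p n \<and> qpoch x p n \<le> 1"
  unfolding qpoch_def using assms
  by (auto intro!: prod_nonneg prod_le_1 mult_le_one power_le_one mult_nonneg_nonneg)

lemma qpoch_ge_power:
  assumes "0 \<le> x" "x \<le> r" "r \<le> 1" "0 \<le> p" "p \<le> 1"
  shows "(1 - r) ^ n \<le> qpoch x p n"
proof -
  have "1 - r \<le> 1 - p ^ j * x" for j
    using mult_mono[of "p ^ j" 1 x r] assms by (simp add: power_le_one)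
  hence "(\<Prod>j<n. 1 - r) \<le> (\<Prod>j<n. 1 - p ^ j * x)"
    using assms by (intro prod_mono) auto
  thus ?thesis
    by (simp add: qpoch_def)
qed

lemma qpoch_LIMSEQ:
  assumes "\<bar>p\<bar> < 1"
  shows "qpoch x p \<longlonglongrightarrow> qpoch_inf x p"
proof -
  have "summable (\<lambda>j. norm (1 - p ^ j * x - 1))"
    using assms by (simp add: abs_mult power_abs summable_mult2 summable_geometric)
  hence "convergent_prod (\<lambda>j. 1 - p ^ j * x)"
    by (intro abs_convergent_prod_imp_convergent_prod summable_imp_abs_convergent_prod)
  hence "(\<lambda>n. \<Prod>j\<le>n. 1 - p ^ j * x) \<longlonglongrightarrow> qpoch_inf x p"
    unfolding qpoch_inf_def by (rule convergent_prod_LIMSEQ)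
  hence "(\<lambda>n. qpoch x p (Suc n)) \<longlonglongrightarrow> qpoch_inf x p"
    by (simp add: qpoch_def lessThan_Suc_atMost)
  thus ?thesis
    by (simp only: filterlim_sequentially_Suc)
qed

lemma qpoch_inf_nz:
  assumes "0 \<le> x" "x < 1" "0 \<le> p" "p < 1"
  shows "qpoch_inf x p \<noteq> 0"
proof -
  have "summable (\<lambda>j. norm (1 - p ^ j * x - 1))"
    using assms by (simp add: abs_mult power_abs summable_mult2 summable_geometric)
  hence "convergent_prod (\<lambda>j. 1 - p ^ j * x)"
    by (intro abs_convergent_prod_imp_convergent_prod summable_imp_abs_convergent_prod)
  moreover have "1 - p ^ j * x \<noteq> 0" for j
    using mult_mono[of "p ^ j" 1 x x] assms by (simp add: power_le_one)
  ultimately show ?thesis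
    unfolding qpoch_inf_def by (simp add: prodinf_nonzero)
qed

text \<open>Keeps denominators positive: those met below are mostly 1 minus \<open>p\<close> times
  at most three numbers in (0, 1]. Shorter products are padded with 1.\<close>

lemma mult4_less_one:
  fixes p u v w :: real
  assumes p: "0 < p" "p < 1"
    and "0 < u" "u \<le> 1" "0 < v" "v \<le> 1" "0 < w" "w \<le> 1"
  shows "p * u * v * w < 1"
proof -
  have "u * v * w \<le> 1"
    using assms by (simp add: mult_le_one)
  hence "p * (u * v * w) \<le> p * 1"
    using p by (intro mult_left_mono) auto
  moreover have "p * u * v * w = p * (u * v * w)"
    by simp
  ultimately show ?thesis
    using p by linarith
qed

section \<open>The summand of mixed base and its term ratio\<close>

text \<open>The factor of a very-well-poised summand of mixed base \<open>p\<close>, \<open>p\<^sup>2\<close> that remains when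
  \<open>1 - a p\<^sup>3\<^sup>k\<close> is split off. The lemmas about it assume \<open>p a = x y z\<close>, so that the first three
  denominator bases are the well-poised partners \<open>a p\<^sup>2 / x\<close>, \<open>a p\<^sup>2 / y\<close>, \<open>a p\<^sup>2 / z\<close>
  of the numerators.\<close>

definition quad_core :: "real \<Rightarrow> real \<Rightarrow> real \<Rightarrow> real \<Rightarrow> real \<Rightarrow> real \<Rightarrow> nat \<Rightarrow> real" where
  "quad_core p a x y z d k =
     qpoch x p k * qpoch y p k * qpoch z p k * qpoch d (p\<^sup>2) k
     / (qpoch (p * y * z) (p\<^sup>2) k * qpoch (p * x * z) (p\<^sup>2) k * qpoch (p * x * y) (p\<^sup>2) k
        * qpoch (p * a / d) p k)
     * (a / d) ^ k * p ^ (\<Sum>{..k})"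

text \<open>The very-well-poised factor is not divided by \<open>1 - a\<close>, so the term at
  \<open>k = 0\<close> is \<open>1 - a\<close> instead of 1.\<close>

definition quad_term :: "real \<Rightarrow> real \<Rightarrow> real \<Rightarrow> real \<Rightarrow> real \<Rightarrow> real \<Rightarrow> nat \<Rightarrow> real" where
  "quad_term p a x y z d k = (1 - a * p ^ (3 * k)) * quad_core p a x y z d k"

lemma quad_core_Suc:
  fixes p a x y z d :: real and k :: nat
  defines "Y \<equiv> p ^ k"
  shows "quad_core p a x y z d (Suc k) = quad_core p a x y z d k *
    ((1 - x * Y) * (1 - y * Y) * (1 - z * Y) * (1 - d * Y\<^sup>2) * (a / d) * (p * Y)
     / ((1 - p * y * z * Y\<^sup>2) * (1 - p * x * z * Y\<^sup>2) * (1 - p * x * y * Y\<^sup>2) * (1 - p * a / d * Y)))"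
proof -
  have 1: "(p\<^sup>2) ^ k = Y\<^sup>2"
    by (simp add: Y_def power_mult [symmetric] mult.commute)
  show ?thesis
    unfolding quad_core_def qpoch_Suc 1 Y_def [symmetric]
    by (simp add: power_add mult_ac flip: Y_def)
qed

section \<open>Polynomial identities behind the two certificates\<close>

text \<open>With \<open>Y = p ^ k\<close> and \<open>e = 1 / d\<close>, this is what remains of the
  first telescoping relation once \<open>1 - a * Y ^ 3\<close> has cancelled, the common factor
  \<open>p * a * Y * (1 - x * Y) * (1 - y * Y) * (1 - z * Y)\<close> is divided out and denominators
  are cleared.\<close>

lemma cert1_polynomial_identity:
  fixes p a x y z e Y :: real
  assumes "p * a = x * y * z"
  shows "Y\<^sup>2 * (1 - a * p ^ 3 * Y ^ 3) * ((1 - p * y * z * e) * (1 - p * x * z * e) * (1 - p * x * y * e))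
    = e * (1 - a * e * p ^ 3 * Y) * ((1 - p * y * z * Y\<^sup>2) * (1 - p * x * z * Y\<^sup>2) * (1 - p * x * y * Y\<^sup>2))
     - (e - Y\<^sup>2) * ((1 - a * p ^ 3 * Y ^ 3) * (1 - a * e * p\<^sup>2 * Y) * (1 - a * e * p ^ 3 * Y)
         + a * e * p\<^sup>2 * Y * ((1 - p * x * Y) * (1 - p * y * Y) * (1 - p * z * Y)))"
  using assms by algebra

text \<open>The second telescoping relation, divided by \<open>quad_core\<close> and cleared of
  denominators, again with \<open>e = 1 / d\<close>. Substituting \<open>y * z\<close> for
  \<open>p\<close> leaves an unconditional polynomial identity.\<close>

lemma cert2_polynomial_identity:
  fixes p a y z e Y :: real
  assumes "y * z = p"
  shows "(1 - a * Y ^ 3) * ((1 - p * a * z * Y\<^sup>2) * (1 - p * a * y * Y\<^sup>2))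
       * ((1 - p * a * e * Y) * (1 - p\<^sup>2 * a * e * Y))
     - (1 - p * a * z * e) * (1 - p * a * y * e) * (1 - p\<^sup>2 * a * Y ^ 3) * ((1 - a * Y) * (1 - p * a * Y)) * Y\<^sup>2
     = (1 - Y\<^sup>2) * (1 - p * a * (a * e) * Y\<^sup>2) * (1 - p\<^sup>2 * a * e * Y)
        * ((1 - p * a * z * Y\<^sup>2) * (1 - p * a * y * Y\<^sup>2))
      - (1 - a * Y) * (1 - y * Y) * (1 - z * Y) * (a * e - a * Y\<^sup>2) * p * Y * (1 - p ^ 3 * a * (a * e) * Y\<^sup>2)"
  unfolding assms [symmetric] by algebra

section \<open>First contiguous relation: x, y, z scaled by p\<close>

text \<open>Makes the shifted summand a rational multiple, in \<open>Y\<close>, of the original one,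
  so that telescoping becomes a question about rational functions.\<close>

lemma quad_core_shift1:
  fixes p a x y z d :: real and k :: nat
  defines "Y \<equiv> p ^ k"
  assumes nz: "x \<noteq> 1" "y \<noteq> 1" "z \<noteq> 1" "p * y * z \<noteq> 1" "p * x * z \<noteq> 1" "p * x * y \<noteq> 1"
    "p * a / d \<noteq> 1" "p\<^sup>2 * a / d \<noteq> 1" "p ^ 3 * a / d \<noteq> 1"
  shows "quad_core p (p ^ 3 * a) (p * x) (p * y) (p * z) d k = quad_core p a x y z d k *
    ((1 - x * Y) * (1 - y * Y) * (1 - z * Y) / ((1 - x) * (1 - y) * (1 - z))
     * ((1 - p * y * z) * (1 - p * x * z) * (1 - p * x * y)
        / ((1 - p * y * z * Y\<^sup>2) * (1 - p * x * z * Y\<^sup>2) * (1 - p * x * y * Y\<^sup>2)))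
     * ((1 - p * a / d) * (1 - p\<^sup>2 * a / d) * (1 - p ^ 3 * a / d)
        / ((1 - p * a / d * Y) * (1 - p\<^sup>2 * a / d * Y) * (1 - p ^ 3 * a / d * Y)))
     * Y ^ 3)"
proof -
  have 1: "(p\<^sup>2) ^ k = Y\<^sup>2" "(p ^ 3) ^ k = Y ^ 3"
    by (simp_all add: Y_def power_mult [symmetric] mult.commute)
  have num: "qpoch (p * u) p k = qpoch u p k * (1 - u * Y) / (1 - u)" if "u \<noteq> 1" for u
    using qpoch_shift[of u p k] that by (simp add: Y_def field_simps)
  have den: "qpoch (p * (p * u) * (p * v)) (p\<^sup>2) k
      = qpoch (p * u * v) (p\<^sup>2) k * (1 - p * u * v * Y\<^sup>2) / (1 - p * u * v)"
    if "p * u * v \<noteq> 1" for u v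
  proof -
    have *: "p * (p * u) * (p * v) = p\<^sup>2 * (p * u * v)"
      by (simp add: power2_eq_square)
    show ?thesis
      unfolding * using qpoch_shift[of "p * u * v" "p\<^sup>2" k] that unfolding 1
      by (simp add: nonzero_eq_divide_eq mult_ac)
  qed
  \<comment> \<open>This factor has base \<open>p\<close> while \<open>a\<close> is scaled by
    \<open>p ^ 3\<close>, so three single shifts are needed. The other denominators have base
    \<open>p^2\<close> and move by \<open>p^2\<close>, one shift each.\<close>
  have "qpoch (p * (p ^ 3 * a) / d) p k = qpoch (p * (p ^ 3 * a / d)) p k"
    by simp
  also have "\<dots> = qpoch (p * (p\<^sup>2 * a / d)) p k * (1 - p ^ 3 * a / d * Y) / (1 - p ^ 3 * a / d)"
    unfolding num[OF nz(9)] by (simp add: eval_nat_numeral mult_ac)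
  also have "\<dots> = qpoch (p * (p * a / d)) p k * (1 - p\<^sup>2 * a / d * Y) / (1 - p\<^sup>2 * a / d)
      * (1 - p ^ 3 * a / d * Y) / (1 - p ^ 3 * a / d)"
    unfolding num[OF nz(8)] by (simp add: power2_eq_square mult_ac)
  also have "\<dots> = qpoch (p * a / d) p k * (1 - p * a / d * Y) / (1 - p * a / d)
      * (1 - p\<^sup>2 * a / d * Y) / (1 - p\<^sup>2 * a / d) * (1 - p ^ 3 * a / d * Y) / (1 - p ^ 3 * a / d)"
    unfolding num[OF nz(7)] by simp
  finally have 2: "qpoch (p * (p ^ 3 * a) / d) p k = \<dots>" .
  have 3: "(p ^ 3 * a / d) ^ k = Y ^ 3 * (a / d) ^ k"
    by (simp add: power_mult_distrib power_divide 1)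
  show ?thesis
    unfolding quad_core_def 2 3 num[OF nz(1)] num[OF nz(2)] num[OF nz(3)]
      den[OF nz(4)] den[OF nz(5)] den[OF nz(6)]
    by (simp add: mult_ac)
qed

text \<open>The coefficient beta of relation (1). Apart from \<open>- (p * a)\<close> and the three
  factors \<open>1 - p * y * z / d\<close> and so on, it is the inverse of the constants in
  \<open>quad_core_shift1\<close>. The factor \<open>- (p * a)\<close> makes it tend to 0 under
  iteration.\<close>

definition quad_factor1 :: "real \<Rightarrow> real \<Rightarrow> real \<Rightarrow> real \<Rightarrow> real \<Rightarrow> real \<Rightarrow> real" where
  "quad_factor1 p a x y z d =
     - (p * a) * ((1 - p * y * z / d) * (1 - p * x * z / d) * (1 - p * x * y / d))
      * ((1 - x) * (1 - y) * (1 - z))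
      / ((1 - p * y * z) * (1 - p * x * z) * (1 - p * x * y)
         * ((1 - p * a / d) * (1 - p\<^sup>2 * a / d) * (1 - p ^ 3 * a / d)))"

text \<open>A Gosper-type certificate: its numerator, of degree 5 in \<open>Y = p\<^sup>k\<close>, is forced by its values
  at \<open>1/x\<close>, \<open>1/y\<close>, \<open>1/z\<close> and its extreme coefficients.\<close>
definition quad_cert1 :: "real \<Rightarrow> real \<Rightarrow> real \<Rightarrow> real \<Rightarrow> real \<Rightarrow> real \<Rightarrow> real \<Rightarrow> real" where
  "quad_cert1 p a x y z d Y =
     - (1 - a * Y ^ 3) - p * a / d * Y * ((1 - x * Y) * (1 - y * Y) * (1 - z * Y))
      / ((1 - p * a / d * Y) * (1 - p\<^sup>2 * a / d * Y))"

text \<open>Division by \<open>quad_core\<close> at \<open>k\<close> turns the claim into a rational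
  identity in \<open>Y = p ^ k\<close>, which reduces to \<open>cert1_polynomial_identity\<close>.
  The ranges of the parameters and \<open>a \<le> d\<close> keep all denominators nonzero.\<close>

lemma quad_term_telescope1:
  fixes p a x y z d :: real and k :: nat
  defines "s \<equiv> a / d"
  defines "\<beta> \<equiv> quad_factor1 p a x y z d"
  defines "\<gamma> \<equiv> quad_cert1 p a x y z d"
  assumes p: "0 < p" "p < 1" and x: "0 < x" "x < 1" and y: "0 < y" "y < 1" and z: "0 < z" "z < 1"
    and d: "0 < d" and a: "p * a = x * y * z" "a \<le> d"
  shows "quad_term p a x y z d k - \<beta> * quad_term p (p ^ 3 * a) (p * x) (p * y) (p * z) d k
    = quad_core p a x y z d (Suc k) * \<gamma> (p ^ Suc k) - quad_core p a x y z d k * \<gamma> (p ^ k)"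
proof -
  define Y where "Y = p ^ k"
  have Y: "0 < Y" "Y \<le> 1"
    using p by (auto simp: Y_def power_le_one)
  have "0 < p * a"
    unfolding a(1) using x y z by simp
  hence a0: "0 < a"
    using p by (simp add: zero_less_mult_iff)
  note lt1 = mult4_less_one[OF p]
  have Y2: "0 < Y\<^sup>2" "Y\<^sup>2 \<le> 1"
    using Y by (auto simp: power_le_one)
  have s: "0 < a / d" "a / d \<le> 1"
    using a0 d a(2) by auto
  have pp: "p\<^sup>2 \<le> 1" "0 < p" "p \<le> 1"
    using p by (auto simp: power_le_one)
  note lt = lt1[of y z 1] lt1[of x z 1] lt1[of x y 1] lt1[of y z "Y\<^sup>2"] lt1[of x z "Y\<^sup>2"] lt1[of x y "Y\<^sup>2"]
    lt1[of 1 "a / d" 1] lt1[of p "a / d" 1] lt1[of "p\<^sup>2" "a / d" 1]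
    lt1[of 1 "a / d" Y] lt1[of p "a / d" Y] lt1[of "p\<^sup>2" "a / d" Y]
  have pw: "p * p = p\<^sup>2" "p * p\<^sup>2 = p ^ 3"
    by (auto simp: eval_nat_numeral)
  have "p * y * z < 1" "p * x * z < 1" "p * x * y < 1"
    "p * y * z * Y\<^sup>2 < 1" "p * x * z * Y\<^sup>2 < 1" "p * x * y * Y\<^sup>2 < 1"
    "p * a / d < 1" "p\<^sup>2 * a / d < 1" "p ^ 3 * a / d < 1"
    "p * a / d * Y < 1" "p\<^sup>2 * a / d * Y < 1" "p ^ 3 * a / d * Y < 1"
    using lt x y z s Y Y2 pp by (simp_all add: pw)
  hence nz: "1 - p * y * z \<noteq> 0" "1 - p * x * z \<noteq> 0" "1 - p * x * y \<noteq> 0"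
    "1 - p * y * z * Y\<^sup>2 \<noteq> 0" "1 - p * x * z * Y\<^sup>2 \<noteq> 0" "1 - p * x * y * Y\<^sup>2 \<noteq> 0"
    "1 - p * a / d \<noteq> 0" "1 - p\<^sup>2 * a / d \<noteq> 0" "1 - p ^ 3 * a / d \<noteq> 0"
    "1 - p * a / d * Y \<noteq> 0" "1 - p\<^sup>2 * a / d * Y \<noteq> 0" "1 - p ^ 3 * a / d * Y \<noteq> 0"
    by linarith+
  define P B D1 D2 D3 E G P' where defs: "P = (1 - x * Y) * (1 - y * Y) * (1 - z * Y)"
    "B = (1 - p * y * z * Y\<^sup>2) * (1 - p * x * z * Y\<^sup>2) * (1 - p * x * y * Y\<^sup>2)"
    "D1 = 1 - p * a / d * Y" "D2 = 1 - p\<^sup>2 * a / d * Y" "D3 = 1 - p ^ 3 * a / d * Y"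
    "E = (1 - p * y * z / d) * (1 - p * x * z / d) * (1 - p * x * y / d)"
    "G = 1 - a * p ^ 3 * Y ^ 3" "P' = (1 - p * x * Y) * (1 - p * y * Y) * (1 - p * z * Y)"
  have BD: "B \<noteq> 0" "D1 \<noteq> 0" "D2 \<noteq> 0" "D3 \<noteq> 0"
    using nz by (auto simp: defs)
  have key: "a * E * G * Y\<^sup>2 = s * D3 * B - (1 - d * Y\<^sup>2) * s * (G * D2 * D3 + s * p\<^sup>2 * Y * P')"
  proof -
    have "Y\<^sup>2 * G * E = 1 / d * D3 * B - (1 / d - Y\<^sup>2) * (G * D2 * D3 + a / d * p\<^sup>2 * Y * P')"
      using cert1_polynomial_identity[OF a(1), of Y "1 / d"] by (simp add: defs mult_ac)
    hence "a * E * G * Y\<^sup>2 = a * (1 / d * D3 * B - (1 / d - Y\<^sup>2) * (G * D2 * D3 + a / d * p\<^sup>2 * Y * P'))"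
      by (simp add: mult_ac)
    also have "\<dots> = s * D3 * B - (1 - d * Y\<^sup>2) * s * (G * D2 * D3 + s * p\<^sup>2 * Y * P')"
      using d by (simp add: s_def field_simps)
    finally show ?thesis .
  qed
  define C where "C = quad_core p a x y z d k"
  have C': "quad_core p a x y z d (Suc k) = C * (P * (1 - d * Y\<^sup>2) * s * (p * Y) / (B * D1))"
    by (simp add: quad_core_Suc C_def Y_def defs s_def)
  have \<gamma>: "\<gamma> Y = - (1 - a * Y ^ 3) - s * p * Y * P / (D1 * D2)"
    by (simp add: \<gamma>_def quad_cert1_def defs s_def mult_ac)
  have "\<gamma> (p * Y) = - G - s * p\<^sup>2 * Y * P' / (D2 * D3)"
    by (simp add: \<gamma>_def quad_cert1_def defs s_def mult_ac eval_nat_numeral)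
  hence \<gamma>': "\<gamma> (p ^ Suc k) = - G - s * p\<^sup>2 * Y * P' / (D2 * D3)"
    by (simp add: Y_def)
  have \<beta>: "\<beta> * quad_core p (p ^ 3 * a) (p * x) (p * y) (p * z) d k
      = - (C * (p * a * E * P * Y ^ 3 / (B * (D1 * D2 * D3))))"
  proof -
    \<comment> \<open>\<open>N\<close>, \<open>M\<close> and \<open>K\<close> stand for the
      constants that \<open>quad_factor1\<close> and \<open>quad_core_shift1\<close> contribute
      inversely to each other.\<close>
    have cancel: "- A * E * N / (M * K) * (C * (P / N * (M / B) * (K / L) * W))
        = - (C * (A * E * P * W / (B * L)))"
      if "N \<noteq> 0" "M \<noteq> 0" "K \<noteq> 0" for A E N M K C P B L W :: real
      using that by simp
    have "quad_core p (p ^ 3 * a) (p * x) (p * y) (p * z) d k = C * (P / ((1 - x) * (1 - y) * (1 - z))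
     * ((1 - p * y * z) * (1 - p * x * z) * (1 - p * x * y) / B)
     * ((1 - p * a / d) * (1 - p\<^sup>2 * a / d) * (1 - p ^ 3 * a / d) / (D1 * D2 * D3)) * Y ^ 3)"
      using nz x y z by (subst quad_core_shift1) (auto simp: C_def defs Y_def)
    thus ?thesis
      unfolding \<beta>_def quad_factor1_def defs(6) [symmetric] using nz x y z by (simp only:) (rule cancel, auto)
  qed
  have "quad_term p a x y z d k - \<beta> * quad_term p (p ^ 3 * a) (p * x) (p * y) (p * z) d k
    = (1 - a * Y ^ 3) * C - G * (\<beta> * quad_core p (p ^ 3 * a) (p * x) (p * y) (p * z) d k)"
    by (simp add: quad_term_def C_def defs Y_def power_mult [symmetric] mult_ac)
  \<comment> \<open>The product \<open>a * E * G * Y^2\<close> is kept together so that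
    \<open>key\<close> can rewrite it.\<close>
  also have "\<dots> = (1 - a * Y ^ 3) * C + C * (p * Y * P * (a * E * G * Y\<^sup>2) / (B * (D1 * D2 * D3)))"
    unfolding \<beta> by (simp add: eval_nat_numeral mult_ac)
  also have "p * Y * P * (a * E * G * Y\<^sup>2) / (B * (D1 * D2 * D3))
     = P * (1 - d * Y\<^sup>2) * s * (p * Y) / (B * D1) * (- G - s * p\<^sup>2 * Y * P' / (D2 * D3)) + s * p * Y * P / (D1 * D2)"
    unfolding key using BD by (simp add: divide_simps) algebra
  also have "(1 - a * Y ^ 3) * C + C * \<dots> = quad_core p a x y z d (Suc k) * \<gamma> (p ^ Suc k) - C * \<gamma> Y"
    unfolding C' \<gamma> \<gamma>' by (simp add: algebra_simps)
  finally show ?thesis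
    by (simp add: C_def Y_def)
qed

section \<open>Second contiguous relation: a scaled by p^2 when x = a and y z = p\<close>

lemma quad_core_shift2:
  fixes p a y z d :: real and k :: nat
  defines "Y \<equiv> p ^ k"
  assumes nz: "a \<noteq> 1" "p * a \<noteq> 1" "p * a * z \<noteq> 1" "p * a * y \<noteq> 1" "p * a / d \<noteq> 1" "p\<^sup>2 * a / d \<noteq> 1"
  shows "quad_core p (p\<^sup>2 * a) (p\<^sup>2 * a) y z d k = quad_core p a a y z d k *
    ((1 - a * Y) * (1 - p * a * Y) / ((1 - a) * (1 - p * a))
     * ((1 - p * a * z) * (1 - p * a * y) / ((1 - p * a * z * Y\<^sup>2) * (1 - p * a * y * Y\<^sup>2)))
     * ((1 - p * a / d) * (1 - p\<^sup>2 * a / d) / ((1 - p * a / d * Y) * (1 - p\<^sup>2 * a / d * Y)))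
     * Y\<^sup>2)"
proof -
  have 1: "(p\<^sup>2) ^ k = Y\<^sup>2"
    by (simp add: Y_def power_mult [symmetric] mult.commute)
  have num: "qpoch (p\<^sup>2 * u) p k = qpoch u p k * (1 - u * Y) * (1 - p * u * Y) / ((1 - u) * (1 - p * u))"
    if "u \<noteq> 1" "p * u \<noteq> 1" for u
    using qpoch_shift2[of u p k] that by (simp add: Y_def nonzero_eq_divide_eq mult_ac)
  have den: "qpoch (p * (p\<^sup>2 * a) * v) (p\<^sup>2) k
      = qpoch (p * a * v) (p\<^sup>2) k * (1 - p * a * v * Y\<^sup>2) / (1 - p * a * v)"
    if "p * a * v \<noteq> 1" for v
  proof -
    have *: "p * (p\<^sup>2 * a) * v = p\<^sup>2 * (p * a * v)"
      by simp
    show ?thesis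
      unfolding * using qpoch_shift[of "p * a * v" "p\<^sup>2" k] that unfolding 1
      by (simp add: nonzero_eq_divide_eq mult_ac)
  qed
  have pp: "p * (p * a / d) = p\<^sup>2 * a / d"
    by (simp add: power2_eq_square)
  have "qpoch (p * (p\<^sup>2 * a) / d) p k = qpoch (p\<^sup>2 * (p * a / d)) p k"
    by (simp add: mult_ac)
  also have "\<dots> = qpoch (p * a / d) p k * (1 - p * a / d * Y) * (1 - p\<^sup>2 * a / d * Y)
      / ((1 - p * a / d) * (1 - p\<^sup>2 * a / d))"
    using num[of "p * a / d"] nz unfolding pp by simp
  finally have 2: "qpoch (p * (p\<^sup>2 * a) / d) p k = \<dots>" .
  have 3: "(p\<^sup>2 * a / d) ^ k = Y\<^sup>2 * (a / d) ^ k"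
    by (simp add: power_mult_distrib power_divide 1)
  show ?thesis
    unfolding quad_core_def 2 3 num[OF nz(1,2)] den[OF nz(3)] den[OF nz(4)]
    by (simp add: mult_ac)
qed

definition quad_factor2 :: "real \<Rightarrow> real \<Rightarrow> real \<Rightarrow> real \<Rightarrow> real \<Rightarrow> real" where
  "quad_factor2 p a y z d = (1 - a) * (1 - p * a) * ((1 - p * a * z / d) * (1 - p * a * y / d))
      / ((1 - p * a * z) * (1 - p * a * y) * ((1 - p * a / d) * (1 - p\<^sup>2 * a / d)))"

text \<open>The factor \<open>1 - Y^2\<close> makes the certificate vanish at \<open>k = 0\<close>,
  so the second relation has no inhomogeneous term. At \<open>p ^ Suc k\<close> it becomes
  \<open>1 - p^2 * Y^2\<close>, which is the denominator \<open>1 - p * y * z * Y^2\<close> of the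
  term ratio when \<open>y * z = p\<close>.\<close>

definition quad_cert2 :: "real \<Rightarrow> real \<Rightarrow> real \<Rightarrow> real \<Rightarrow> real" where
  "quad_cert2 p a d Y = - ((1 - Y\<^sup>2) * (1 - p * a * (a / d) * Y\<^sup>2) / (1 - p * a / d * Y))"

lemma quad_term_telescope2:
  fixes p a y z d :: real and k :: nat
  defines "\<beta> \<equiv> quad_factor2 p a y z d"
  defines "\<gamma> \<equiv> quad_cert2 p a d"
  assumes p: "0 < p" "p < 1" and y: "0 < y" "y < 1" and z: "0 < z" "z < 1"
    and d: "0 < d" and a: "0 < a" "a < 1" "a \<le> d" and yz: "y * z = p"
  shows "quad_term p a a y z d k - \<beta> * quad_term p (p\<^sup>2 * a) (p\<^sup>2 * a) y z d k
    = quad_core p a a y z d (Suc k) * \<gamma> (p ^ Suc k) - quad_core p a a y z d k * \<gamma> (p ^ k)"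
proof -
  define Y where "Y = p ^ k"
  have Y: "0 < Y" "Y \<le> 1"
    using p by (auto simp: Y_def power_le_one)
  note lt1 = mult4_less_one[OF p]
  have Y2: "0 < Y\<^sup>2" "Y\<^sup>2 \<le> 1"
    using Y by (auto simp: power_le_one)
  have s: "0 < a / d" "a / d \<le> 1"
    using d a by auto
  have pp: "0 < p" "p \<le> 1"
    using p by auto
  note lt = lt1[of a 1 1] lt1[of a z 1] lt1[of a y 1] lt1[of a z "Y\<^sup>2"] lt1[of a y "Y\<^sup>2"]
    lt1[of 1 "a / d" 1] lt1[of p "a / d" 1] lt1[of 1 "a / d" Y] lt1[of p "a / d" Y]
    lt1[of p "Y\<^sup>2" 1]
  have pw: "p * p = p\<^sup>2"
    by (simp add: power2_eq_square)
  have "p * a < 1" "p * a * z < 1" "p * a * y < 1" "p * a * z * Y\<^sup>2 < 1" "p * a * y * Y\<^sup>2 < 1"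
    "p * a / d < 1" "p\<^sup>2 * a / d < 1" "p * a / d * Y < 1" "p\<^sup>2 * a / d * Y < 1" "p\<^sup>2 * Y\<^sup>2 < 1"
    using lt a y z s Y Y2 pp by (simp_all add: pw)
  hence nz: "1 - p * a \<noteq> 0" "1 - p * a * z \<noteq> 0" "1 - p * a * y \<noteq> 0"
    "1 - p * a * z * Y\<^sup>2 \<noteq> 0" "1 - p * a * y * Y\<^sup>2 \<noteq> 0"
    "1 - p * a / d \<noteq> 0" "1 - p\<^sup>2 * a / d \<noteq> 0" "1 - p * a / d * Y \<noteq> 0" "1 - p\<^sup>2 * a / d * Y \<noteq> 0"
    "1 - p\<^sup>2 * Y\<^sup>2 \<noteq> 0"
    by linarith+
  define P P2 B D1 D2 E H H' where defs: "P = (1 - a * Y) * (1 - p * a * Y)"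
    "P2 = (1 - a * Y) * (1 - y * Y) * (1 - z * Y)"
    "B = (1 - p * a * z * Y\<^sup>2) * (1 - p * a * y * Y\<^sup>2)"
    "D1 = 1 - p * a / d * Y" "D2 = 1 - p\<^sup>2 * a / d * Y"
    "E = (1 - p * a * z / d) * (1 - p * a * y / d)"
    "H = 1 - p * a * (a / d) * Y\<^sup>2" "H' = 1 - p ^ 3 * a * (a / d) * Y\<^sup>2"
  have BD: "B \<noteq> 0" "D1 \<noteq> 0" "D2 \<noteq> 0"
    using nz by (auto simp: defs)
  have key: "(1 - a * Y ^ 3) * (B * (D1 * D2)) - E * (1 - p\<^sup>2 * a * Y ^ 3) * P * Y\<^sup>2
      = (1 - Y\<^sup>2) * H * D2 * B - P2 * (1 - d * Y\<^sup>2) * (a / d) * (p * Y) * H'"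
  proof -
    have *: "a * (1 / d) - a * Y\<^sup>2 = (1 - d * Y\<^sup>2) * (a / d)"
      using d by (simp add: field_simps)
    show ?thesis
      using cert2_polynomial_identity[OF yz, of a Y "1 / d"] unfolding * by (simp add: defs mult_ac)
  qed
  define C where "C = quad_core p a a y z d k"
  \<comment> \<open>Here \<open>y * z = p\<close> produces the denominator
    \<open>1 - p^2 * Y^2\<close> that the certificate cancels.\<close>
  have "quad_core p a a y z d (Suc k) = C * (P2 * (1 - d * Y\<^sup>2) * (a / d) * (p * Y) / ((1 - p\<^sup>2 * Y\<^sup>2) * B * D1))"
  proof -
    have *: "p * y * z = p\<^sup>2"
      using yz by (simp add: power2_eq_square mult_ac)
    show ?thesis
      unfolding quad_core_Suc * by (simp add: C_def Y_def defs mult_ac)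
  qed
  moreover have "\<gamma> (p ^ Suc k) = - ((1 - p\<^sup>2 * Y\<^sup>2) * H' / D2)"
    unfolding power_Suc Y_def [symmetric] by (simp add: \<gamma>_def quad_cert2_def defs mult_ac eval_nat_numeral)
  ultimately have \<gamma>': "quad_core p a a y z d (Suc k) * \<gamma> (p ^ Suc k)
      = - (C * (P2 * (1 - d * Y\<^sup>2) * (a / d) * (p * Y) * H' / (B * (D1 * D2))))"
    using nz by (simp add: mult_ac)
  have \<gamma>: "\<gamma> Y = - ((1 - Y\<^sup>2) * H / D1)"
    by (simp add: \<gamma>_def quad_cert2_def defs)
  have \<beta>: "\<beta> * quad_core p (p\<^sup>2 * a) (p\<^sup>2 * a) y z d k = C * (E * P * Y\<^sup>2 / (B * (D1 * D2)))"
  proof -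
    have cancel: "N * E / (M * K) * (C * (P / N * (M / B) * (K / L) * W)) = C * (E * P * W / (B * L))"
      if "N \<noteq> 0" "M \<noteq> 0" "K \<noteq> 0" for E N M K C P B L W :: real
      using that by simp
    have "quad_core p (p\<^sup>2 * a) (p\<^sup>2 * a) y z d k = C * (P / ((1 - a) * (1 - p * a))
     * ((1 - p * a * z) * (1 - p * a * y) / B)
     * ((1 - p * a / d) * (1 - p\<^sup>2 * a / d) / (D1 * D2)) * Y\<^sup>2)"
      using nz a by (subst quad_core_shift2) (auto simp: C_def defs Y_def)
    thus ?thesis
      unfolding \<beta>_def quad_factor2_def defs(6) [symmetric] using nz a by (simp only:) (rule cancel, auto)
  qed
  have "quad_term p a a y z d k - \<beta> * quad_term p (p\<^sup>2 * a) (p\<^sup>2 * a) y z d k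
    = (1 - a * Y ^ 3) * C - (1 - p\<^sup>2 * a * Y ^ 3) * (\<beta> * quad_core p (p\<^sup>2 * a) (p\<^sup>2 * a) y z d k)"
    by (simp add: quad_term_def C_def Y_def power_mult [symmetric] mult_ac)
  also have "\<dots> = C * (((1 - a * Y ^ 3) * (B * (D1 * D2)) - E * (1 - p\<^sup>2 * a * Y ^ 3) * P * Y\<^sup>2) / (B * (D1 * D2)))"
    unfolding \<beta> using BD by (simp add: field_simps)
  also have "\<dots> = quad_core p a a y z d (Suc k) * \<gamma> (p ^ Suc k) - C * \<gamma> Y"
  proof -
    have *: "C * ((W * H * D2 * B - T) / (B * (D1 * D2))) = - (C * (T / (B * (D1 * D2)))) - C * - (W * H / D1)"
      for T W
      using BD by (simp add: field_simps)
    show ?thesis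
      unfolding key \<gamma> \<gamma>' by (rule *)
  qed
  finally show ?thesis
    by (simp add: C_def Y_def)
qed

section \<open>A uniform summable majorant\<close>

text \<open>The exponent of \<open>p\<close> is quadratic in \<open>k\<close>, so the term ratio
  \<open>p ^ Suc k / (1 - p) ^ 4\<close> tends to 0. The 4 counts the denominators of
  \<open>quad_core\<close>.\<close>

lemma summable_quad_bound:
  fixes p :: real
  assumes "0 < p" "p < 1"
  shows "summable (\<lambda>k. p ^ \<Sum>{..k} / (1 - p) ^ (4 * k))"
proof -
  have "(\<lambda>k. p ^ Suc k / (1 - p) ^ 4) \<longlonglongrightarrow> 0 / (1 - p) ^ 4"
    using assms by (intro tendsto_divide LIMSEQ_Suc[OF LIMSEQ_power_zero]) auto
  hence "eventually (\<lambda>k. p ^ Suc k / (1 - p) ^ 4 < 1 / 2) sequentially"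
    by (rule order_tendstoD) simp
  then obtain N where N: "p ^ Suc k / (1 - p) ^ 4 < 1 / 2" if "k \<ge> N" for k
    by (auto simp: eventually_sequentially)
  show ?thesis
  proof (rule summable_ratio_test[of "1 / 2" N])
    fix k assume "N \<le> k"
    have "p ^ \<Sum>{..Suc k} / (1 - p) ^ (4 * Suc k)
        = p ^ Suc k / (1 - p) ^ 4 * (p ^ \<Sum>{..k} / (1 - p) ^ (4 * k))"
      by (simp add: power_add)
    moreover have "p ^ Suc k / (1 - p) ^ 4 * (p ^ \<Sum>{..k} / (1 - p) ^ (4 * k))
        \<le> 1 / 2 * (p ^ \<Sum>{..k} / (1 - p) ^ (4 * k))"
      using N[OF \<open>N \<le> k\<close>] assms by (intro mult_right_mono) auto
    ultimately show "norm (p ^ \<Sum>{..Suc k} / (1 - p) ^ (4 * Suc k))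
        \<le> 1 / 2 * norm (p ^ \<Sum>{..k} / (1 - p) ^ (4 * k))"
      using assms by simp
  qed simp
qed

text \<open>Numerators lie in [0, 1] and each of the four denominators is at least
  \<open>(1 - p) ^ k\<close>. The other parameters enter the bound only through
  \<open>(a / d) ^ k\<close>, so it is uniform along both iterations.\<close>

lemma quad_core_bound:
  assumes p: "0 < p" "p < 1" and x: "0 \<le> x" "x \<le> 1" and y: "0 \<le> y" "y \<le> 1" and z: "0 \<le> z" "z \<le> 1"
    and d: "0 < d" "d \<le> 1" and a: "0 \<le> a" "a \<le> d"
  shows "\<bar>quad_core p a x y z d k\<bar> \<le> (a / d) ^ k * (p ^ \<Sum>{..k} / (1 - p) ^ (4 * k))"
proof -
  define N where "N = qpoch x p k * qpoch y p k * qpoch z p k * qpoch d (p\<^sup>2) k"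
  define D where "D = qpoch (p * y * z) (p\<^sup>2) k * qpoch (p * x * z) (p\<^sup>2) k
    * qpoch (p * x * y) (p\<^sup>2) k * qpoch (p * a / d) p k"
  have p2: "0 \<le> p\<^sup>2" "p\<^sup>2 \<le> 1"
    using p by (auto simp: power_le_one)
  have N: "0 \<le> N \<and> N \<le> 1"
    unfolding N_def using p p2 x y z d
    by (intro conjI mult_nonneg_nonneg mult_le_one) (auto simp: qpoch_nonneg_le_1)
  have den: "(1 - p) ^ k \<le> qpoch (p * u * v) (p\<^sup>2) k"
    if "0 \<le> u" "u \<le> 1" "0 \<le> v" "v \<le> 1" for u v
  proof (rule qpoch_ge_power)
    have "p * (u * v) \<le> p * 1"
      using that p by (intro mult_left_mono mult_le_one) auto
    thus "p * u * v \<le> p"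
      by (simp add: mult_ac)
  qed (use p p2 that in auto)
  have "(1 - p) ^ k \<le> qpoch (p * a / d) p k"
    using p d a by (intro qpoch_ge_power) (auto simp: field_simps)
  hence "(1 - p) ^ k * (1 - p) ^ k * (1 - p) ^ k * (1 - p) ^ k \<le> D"
    unfolding D_def using p den x y z
    by (intro mult_mono mult_nonneg_nonneg) (auto intro: order_trans[OF _ den])
  moreover have "(1 - p) ^ (4 * k) = (1 - p) ^ k * (1 - p) ^ k * (1 - p) ^ k * (1 - p) ^ k"
    unfolding power_add [symmetric] by (rule arg_cong[where f = "\<lambda>n. (1 - p) ^ n"]) simp
  ultimately have D: "(1 - p) ^ (4 * k) \<le> D"
    by simp
  have pos: "0 < (1 - p) ^ (4 * k)"
    using p by simp
  with D have "N / D \<le> 1 / (1 - p) ^ (4 * k)"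
    using N by (intro frac_le) auto
  moreover have "0 \<le> N / D"
    using N D pos by simp
  moreover have nn: "0 \<le> (a / d) ^ k * p ^ \<Sum>{..k}"
    using a d p by simp
  ultimately have "N / D * ((a / d) ^ k * p ^ \<Sum>{..k}) \<le> 1 / (1 - p) ^ (4 * k) * ((a / d) ^ k * p ^ \<Sum>{..k})"
    by (intro mult_right_mono)
  moreover have "0 \<le> N / D * ((a / d) ^ k * p ^ \<Sum>{..k})"
    using \<open>0 \<le> N / D\<close> nn by (rule mult_nonneg_nonneg)
  moreover have "quad_core p a x y z d k = N / D * ((a / d) ^ k * p ^ \<Sum>{..k})"
    by (simp add: quad_core_def N_def D_def)
  ultimately show ?thesis
    by (simp add: mult_ac)
qed

lemma quad_core_bound':
  assumes "0 < p" "p < 1" "0 \<le> x" "x \<le> 1" "0 \<le> y" "y \<le> 1" "0 \<le> z" "z \<le> 1"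
    "0 < d" "d \<le> 1" "0 \<le> a" "a \<le> d"
  shows "\<bar>quad_core p a x y z d k\<bar> \<le> p ^ \<Sum>{..k} / (1 - p) ^ (4 * k)"
proof -
  have "(a / d) ^ k * (p ^ \<Sum>{..k} / (1 - p) ^ (4 * k)) \<le> 1 * (p ^ \<Sum>{..k} / (1 - p) ^ (4 * k))"
    using assms by (intro mult_right_mono power_le_one) auto
  thus ?thesis
    using quad_core_bound[OF assms, of k] by simp
qed

lemma quad_core_LIMSEQ:
  assumes "0 < p" "p < 1" "0 \<le> x" "x \<le> 1" "0 \<le> y" "y \<le> 1" "0 \<le> z" "z \<le> 1"
    "0 < d" "d \<le> 1" "0 \<le> a" "a \<le> d"
  shows "quad_core p a x y z d \<longlonglongrightarrow> 0"
  by (rule Lim_null_comparison[OF _ summable_LIMSEQ_zero[OF summable_quad_bound[OF assms(1,2)]]])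
    (simp add: quad_core_bound'[OF assms])

lemma quad_term_bound:
  assumes "0 < p" "p < 1" "0 \<le> x" "x \<le> 1" "0 \<le> y" "y \<le> 1" "0 \<le> z" "z \<le> 1"
    "0 < d" "d \<le> 1" "0 \<le> a" "a \<le> d"
  shows "\<bar>quad_term p a x y z d k\<bar> \<le> (a / d) ^ k * (p ^ \<Sum>{..k} / (1 - p) ^ (4 * k))"
    and "\<bar>quad_term p a x y z d k\<bar> \<le> p ^ \<Sum>{..k} / (1 - p) ^ (4 * k)"
proof -
  have "0 \<le> a * p ^ (3 * k)" "a * p ^ (3 * k) \<le> 1"
    using assms by (auto intro!: mult_le_one power_le_one)
  hence "\<bar>1 - a * p ^ (3 * k)\<bar> \<le> 1"
    by auto
  hence "\<bar>quad_term p a x y z d k\<bar> \<le> 1 * \<bar>quad_core p a x y z d k\<bar>"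
    unfolding quad_term_def abs_mult by (intro mult_right_mono) auto
  thus "\<bar>quad_term p a x y z d k\<bar> \<le> (a / d) ^ k * (p ^ \<Sum>{..k} / (1 - p) ^ (4 * k))"
    "\<bar>quad_term p a x y z d k\<bar> \<le> p ^ \<Sum>{..k} / (1 - p) ^ (4 * k)"
    using quad_core_bound[OF assms, of k] quad_core_bound'[OF assms, of k] by linarith+
qed

lemma summable_quad_term:
  assumes "0 < p" "p < 1" "0 \<le> x" "x \<le> 1" "0 \<le> y" "y \<le> 1" "0 \<le> z" "z \<le> 1"
    "0 < d" "d \<le> 1" "0 \<le> a" "a \<le> d"
  shows "summable (quad_term p a x y z d)"
  by (rule summable_comparison_test'[OF summable_quad_bound[OF assms(1,2)], of 0])
    (simp add: quad_term_bound(2)[OF assms])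

section \<open>The contiguous relations for the sums\<close>

lemma suminf_telescope:
  fixes f f' g :: "nat \<Rightarrow> real"
  assumes "summable f" "summable f'" "g \<longlonglongrightarrow> 0"
    and "\<And>k. f k - b * f' k = g (Suc k) - g k"
  shows "suminf f = b * suminf f' - g 0"
proof -
  have "(\<lambda>k. f k - b * f' k) sums (suminf f - b * suminf f')"
    using assms(1,2) by (intro sums_diff sums_mult summable_sums)
  moreover have "(\<lambda>k. f k - b * f' k) sums (0 - g 0)"
    unfolding assms(4) using assms(3) by (rule telescope_sums)
  ultimately show ?thesis
    using sums_unique2 by fastforce
qed

lemma suminf_quad_term_step1:
  assumes p: "0 < p" "p < 1" and x: "0 < x" "x < 1" and y: "0 < y" "y < 1" and z: "0 < z" "z < 1"
    and d: "0 < d" "d \<le> 1" and a: "p * a = x * y * z" "a \<le> d"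
  shows "suminf (quad_term p a x y z d)
    = quad_factor1 p a x y z d * suminf (quad_term p (p ^ 3 * a) (p * x) (p * y) (p * z) d)
      - quad_cert1 p a x y z d 1"
proof -
  have "0 < p * a"
    unfolding a(1) using x y z by simp
  hence a0: "0 < a"
    using p by (simp add: zero_less_mult_iff)
  have p3: "p ^ 3 \<le> 1"
    using p by (simp add: power_le_one)
  have "p ^ 3 * a \<le> a"
    using a0 p p3 by (intro mult_left_le_one_le) auto
  hence a3: "0 \<le> p ^ 3 * a" "p ^ 3 * a \<le> d"
    using a0 a(2) p by (simp, linarith)
  define g where "g k = quad_core p a x y z d k * quad_cert1 p a x y z d (p ^ k)" for k
  \<comment> \<open>The certificate converges to its value at \<open>Y = 0\<close>, hence
    \<open>quad_core\<close> drives the boundary term at infinity to 0.\<close>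
  have "(\<lambda>k. quad_cert1 p a x y z d (p ^ k)) \<longlonglongrightarrow> quad_cert1 p a x y z d 0"
    unfolding quad_cert1_def using p by (intro tendsto_intros LIMSEQ_power_zero) auto
  hence g: "g \<longlonglongrightarrow> 0 * quad_cert1 p a x y z d 0"
    unfolding g_def using p x y z d a a0 by (intro tendsto_mult quad_core_LIMSEQ) auto
  have "quad_term p a x y z d k - quad_factor1 p a x y z d * quad_term p (p ^ 3 * a) (p * x) (p * y) (p * z) d k
      = g (Suc k) - g k" for k
    unfolding g_def by (rule quad_term_telescope1[OF p x y z d(1) a])
  hence "suminf (quad_term p a x y z d)
      = quad_factor1 p a x y z d * suminf (quad_term p (p ^ 3 * a) (p * x) (p * y) (p * z) d) - g 0"
    using p x y z d a a0 a3 g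
    by (intro suminf_telescope summable_quad_term) (auto simp: mult_le_one)
  \<comment> \<open>Since \<open>quad_core\<close> is 1 at \<open>k = 0\<close>, the surviving
    boundary term is the certificate at \<open>Y = 1\<close>.\<close>
  thus ?thesis
    by (simp add: g_def quad_core_def)
qed

lemma suminf_quad_term_step2:
  assumes p: "0 < p" "p < 1" and y: "0 < y" "y < 1" and z: "0 < z" "z < 1"
    and d: "0 < d" "d \<le> 1" and a: "0 < a" "a < 1" "a \<le> d" and yz: "y * z = p"
  shows "suminf (quad_term p a a y z d)
    = quad_factor2 p a y z d * suminf (quad_term p (p\<^sup>2 * a) (p\<^sup>2 * a) y z d)"
proof -
  have p2: "p\<^sup>2 \<le> 1"
    using p by (simp add: power_le_one)
  have "p\<^sup>2 * a \<le> a"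
    using a p2 by (intro mult_left_le_one_le) auto
  hence a2: "0 \<le> p\<^sup>2 * a" "p\<^sup>2 * a \<le> d" "p\<^sup>2 * a \<le> 1"
    using a p by (simp, linarith+)
  define g where "g k = quad_core p a a y z d k * quad_cert2 p a d (p ^ k)" for k
  have "(\<lambda>k. quad_cert2 p a d (p ^ k)) \<longlonglongrightarrow> quad_cert2 p a d 0"
    unfolding quad_cert2_def using p by (intro tendsto_intros LIMSEQ_power_zero) auto
  hence g: "g \<longlonglongrightarrow> 0 * quad_cert2 p a d 0"
    unfolding g_def using p y z d a by (intro tendsto_mult quad_core_LIMSEQ) auto
  have tel: "quad_term p a a y z d k - quad_factor2 p a y z d * quad_term p (p\<^sup>2 * a) (p\<^sup>2 * a) y z d k
      = g (Suc k) - g k" for k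
    unfolding g_def by (rule quad_term_telescope2[OF p y z d(1) a yz])
  have "suminf (quad_term p a a y z d)
      = quad_factor2 p a y z d * suminf (quad_term p (p\<^sup>2 * a) (p\<^sup>2 * a) y z d) - g 0"
    using p y z d a a2 g tel by (intro suminf_telescope summable_quad_term) auto
  thus ?thesis
    by (simp add: g_def quad_cert2_def)
qed

section \<open>Product evaluation by iterating the second relation\<close>

text \<open>The term at \<open>k = 0\<close> is \<open>1 - a\<close>, and every later term carries
  at least one factor \<open>a / d \<le> 1\<close>. The bound is linear in \<open>a\<close> and
  gives the limit 1 of the sum as \<open>a\<close> tends to 0.\<close>

lemma suminf_quad_term_near_1:
  assumes p: "0 < p" "p < 1" and y: "0 \<le> y" "y \<le> 1" and z: "0 \<le> z" "z \<le> 1"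
    and d: "0 < d" "d \<le> 1" and a: "0 \<le> a" "a \<le> d"
  shows "\<bar>suminf (quad_term p a a y z d) - (1 - a)\<bar>
    \<le> a / d * (\<Sum>k. p ^ \<Sum>{..Suc k} / (1 - p) ^ (4 * Suc k))"
proof -
  note B = summable_quad_bound[OF p]
  have 0: "suminf (quad_term p a a y z d) - (1 - a) = (\<Sum>k. quad_term p a a y z d (Suc k))"
    using suminf_split_head[OF summable_quad_term[of p a y z d a]] assms
    by (simp add: quad_term_def quad_core_def)
  have B': "summable (\<lambda>k. p ^ \<Sum>{..Suc k} / (1 - p) ^ (4 * Suc k))"
    using B by (subst summable_Suc_iff)
  have le: "norm (quad_term p a a y z d (Suc k)) \<le> a / d * (p ^ \<Sum>{..Suc k} / (1 - p) ^ (4 * Suc k))" for k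
  proof -
    have "\<bar>quad_term p a a y z d (Suc k)\<bar> \<le> (a / d) ^ Suc k * (p ^ \<Sum>{..Suc k} / (1 - p) ^ (4 * Suc k))"
      using assms by (intro quad_term_bound) auto
    also have "\<dots> \<le> (a / d) ^ 1 * (p ^ \<Sum>{..Suc k} / (1 - p) ^ (4 * Suc k))"
      using assms by (intro mult_right_mono power_decreasing) auto
    finally show ?thesis
      by simp
  qed
  have "norm (\<Sum>k. quad_term p a a y z d (Suc k)) \<le> (\<Sum>k. a / d * (p ^ \<Sum>{..Suc k} / (1 - p) ^ (4 * Suc k)))"
    by (rule norm_suminf_le[OF le summable_mult[OF B']])
  thus ?thesis
    unfolding 0 suminf_mult[OF B'] by simp
qed

text \<open>Rahman's quadratic summation formula, in the limit where one of the free numerator parameters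
  tends to \<open>0\<close>.\<close>
lemma suminf_quad_term:
  assumes p: "0 < p" "p < 1" and y: "0 < y" "y < 1" and z: "0 < z" "z < 1"
    and d: "0 < d" "d \<le> 1" and a: "0 < a" "a < 1" "a \<le> d" and yz: "y * z = p"
  shows "suminf (quad_term p a a y z d) =
    qpoch_inf a (p\<^sup>2) * qpoch_inf (p * a) (p\<^sup>2)
    * (qpoch_inf (p * a * z / d) (p\<^sup>2) * qpoch_inf (p * a * y / d) (p\<^sup>2))
    / (qpoch_inf (p * a * z) (p\<^sup>2) * qpoch_inf (p * a * y) (p\<^sup>2)
       * (qpoch_inf (p * a / d) (p\<^sup>2) * qpoch_inf (p\<^sup>2 * a / d) (p\<^sup>2)))"
proof -
  define r where "r = p\<^sup>2"
  have r: "0 < r" "r < 1"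
    using p by (auto simp: r_def power_less_one_iff)
  define S where "S b = suminf (quad_term p b b y z d)" for b
  define R where "R n = qpoch a r n * qpoch (p * a) r n * (qpoch (p * a * z / d) r n * qpoch (p * a * y / d) r n)
    / (qpoch (p * a * z) r n * qpoch (p * a * y) r n
       * (qpoch (p * a / d) r n * qpoch (p\<^sup>2 * a / d) r n))" for n
  have rn: "0 < r ^ n * a" "r ^ n * a < 1" "r ^ n * a \<le> d" for n
  proof -
    have "r ^ n * a \<le> a"
      using r a by (intro mult_left_le_one_le power_le_one) auto
    thus "0 < r ^ n * a" "r ^ n * a < 1" "r ^ n * a \<le> d"
      using r a by (simp, linarith+)
  qed
  \<comment> \<open>Each use of the second relation scales \<open>a\<close> by
    \<open>r = p^2\<close>, so the factors \<open>quad_factor2\<close> assemble into q-shifted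
    factorials of base \<open>r\<close>.\<close>
  have R: "S a = R n * S (r ^ n * a)" for n
  proof (induction n)
    case (Suc n)
    have "S (r ^ n * a) = quad_factor2 p (r ^ n * a) y z d * S (r ^ Suc n * a)"
      using suminf_quad_term_step2[OF p y z d rn yz, of n] by (simp add: S_def r_def mult_ac)
    moreover have "R n * quad_factor2 p (r ^ n * a) y z d = R (Suc n)"
      by (simp add: R_def qpoch_Suc quad_factor2_def mult_ac)
    ultimately show ?case
      using Suc.IH by (metis mult.assoc)
  qed (simp add: R_def)
  have lim: "(\<lambda>n. r ^ n * a) \<longlonglongrightarrow> 0"
    using r by (intro tendsto_mult_left_zero LIMSEQ_power_zero) auto
  define K where "K = (\<Sum>k. p ^ \<Sum>{..Suc k} / (1 - p) ^ (4 * Suc k))"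
  have "(\<lambda>n. S (r ^ n * a) - (1 - r ^ n * a)) \<longlonglongrightarrow> 0"
  proof (rule Lim_null_comparison)
    show "\<forall>\<^sub>F n in sequentially. norm (S (r ^ n * a) - (1 - r ^ n * a)) \<le> r ^ n * a / d * K"
      using suminf_quad_term_near_1[OF p _ _ _ _ d] rn y z
      by (auto simp: S_def K_def less_imp_le intro!: always_eventually)
    show "(\<lambda>n. r ^ n * a / d * K) \<longlonglongrightarrow> 0"
      using tendsto_mult_right[OF tendsto_divide[OF lim tendsto_const[of d]], of K] d by simp
  qed
  from tendsto_add[OF this tendsto_diff[OF tendsto_const[of 1] lim]]
  have S: "(\<lambda>n. S (r ^ n * a)) \<longlonglongrightarrow> 1"
    by simp
  have ad: "0 < a / d" "a / d \<le> 1"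
    using a d by auto
  have nz: "qpoch_inf (p * a * z) r \<noteq> 0" "qpoch_inf (p * a * y) r \<noteq> 0"
    "qpoch_inf (p * a / d) r \<noteq> 0" "qpoch_inf (p\<^sup>2 * a / d) r \<noteq> 0"
    using p a y z d r ad mult4_less_one[OF p, of a z 1] mult4_less_one[OF p, of a y 1]
      mult4_less_one[OF p, of 1 "a / d" 1] mult4_less_one[OF p, of p "a / d" 1]
    by (simp_all add: qpoch_inf_nz power2_eq_square)
  have "R \<longlonglongrightarrow> qpoch_inf a r * qpoch_inf (p * a) r * (qpoch_inf (p * a * z / d) r * qpoch_inf (p * a * y / d) r)
    / (qpoch_inf (p * a * z) r * qpoch_inf (p * a * y) r
       * (qpoch_inf (p * a / d) r * qpoch_inf (p\<^sup>2 * a / d) r))" (is "_ \<longlonglongrightarrow> ?L")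
    unfolding R_def using r nz by (intro tendsto_intros qpoch_LIMSEQ) auto
  \<comment> \<open>By \<open>R\<close> the product sequence is constantly \<open>S a\<close>, so
    its limit is the value sought.\<close>
  from tendsto_mult[OF this S] have "(\<lambda>n. S a) \<longlonglongrightarrow> ?L"
    by (simp flip: R)
  hence "S a = ?L"
    by (simp add: LIMSEQ_const_iff)
  thus ?thesis
    by (simp add: S_def r_def)
qed

section \<open>Series expansion by iterating the first relation\<close>

text \<open>After \<open>N\<close> steps of relation (1) the remainder is \<open>c N * S N\<close>.
  It vanishes in the limit because the factors of \<open>c\<close> tend to 0 while the sums
  \<open>S N\<close> are bounded uniformly.\<close>

lemma quad_term_accelerated:
  fixes p a x y z d :: real
  defines "c \<equiv> \<lambda>n. \<Prod>j<n. quad_factor1 p ((p ^ 3) ^ j * a) (p ^ j * x) (p ^ j * y) (p ^ j * z) d"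
  assumes p: "0 < p" "p < 1" and x: "0 < x" "x < 1" and y: "0 < y" "y < 1" and z: "0 < z" "z < 1"
    and d: "0 < d" "d \<le> 1" and a: "p * a = x * y * z" "a \<le> d"
  shows "(\<lambda>n. c n * - quad_cert1 p ((p ^ 3) ^ n * a) (p ^ n * x) (p ^ n * y) (p ^ n * z) d 1)
    sums suminf (quad_term p a x y z d)"
proof -
  define \<beta> where "\<beta> n = quad_factor1 p ((p ^ 3) ^ n * a) (p ^ n * x) (p ^ n * y) (p ^ n * z) d" for n
  define \<alpha> where "\<alpha> n = - quad_cert1 p ((p ^ 3) ^ n * a) (p ^ n * x) (p ^ n * y) (p ^ n * z) d 1" for n
  define S where "S n = suminf (quad_term p ((p ^ 3) ^ n * a) (p ^ n * x) (p ^ n * y) (p ^ n * z) d)" for n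
  define K where "K = (\<Sum>k. p ^ \<Sum>{..k} / (1 - p) ^ (4 * k))"
  have "0 < p * a"
    unfolding a(1) using x y z by simp
  hence a0: "0 < a"
    using p by (simp add: zero_less_mult_iff)
  have c_Suc: "c (Suc n) = c n * \<beta> n" for n
    by (simp add: c_def \<beta>_def)
  have p3: "0 < p ^ 3" "p ^ 3 < 1"
    using p by (auto simp: power_less_one_iff)
  have in01: "0 < p ^ n * u" "p ^ n * u < 1" if "0 < u" "u < 1" for n u
  proof -
    have "p ^ n * u \<le> u"
      using p that by (intro mult_left_le_one_le power_le_one) auto
    thus "0 < p ^ n * u" "p ^ n * u < 1"
      using p that by (simp, linarith)
  qed
  have an: "0 < (p ^ 3) ^ n * a" "(p ^ 3) ^ n * a \<le> d" for n
  proof -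
    have "(p ^ 3) ^ n \<le> 1" "0 \<le> (p ^ 3) ^ n"
      using power_le_one[of "p ^ 3" n] zero_le_power[of "p ^ 3" n] p3 by linarith+
    hence "(p ^ 3) ^ n * a \<le> a"
      using a0 by (intro mult_left_le_one_le) linarith+
    thus "0 < (p ^ 3) ^ n * a" "(p ^ 3) ^ n * a \<le> d"
      using p a(2) a0 by (simp, linarith)
  qed
  have step: "S n = \<beta> n * S (Suc n) + \<alpha> n" for n
  proof -
    \<comment> \<open>The condition \<open>p * a = x * y * z\<close> survives the step: both sides
      are scaled by \<open>p ^ 3\<close>.\<close>
    have "p * ((p ^ 3) ^ n * a) = (p ^ 3) ^ n * (p * a)"
      by simp
    also have "\<dots> = (p ^ n * x) * (p ^ n * y) * (p ^ n * z)"
      unfolding a(1) by (simp add: eval_nat_numeral power_mult_distrib mult_ac)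
    finally have "p * ((p ^ 3) ^ n * a) = (p ^ n * x) * (p ^ n * y) * (p ^ n * z)" .
    from suminf_quad_term_step1[OF p in01[OF x] in01[OF y] in01[OF z] d this an(2)]
    show ?thesis
      unfolding S_def \<alpha>_def \<beta>_def power_Suc mult.assoc by linarith
  qed
  have partial: "(\<Sum>n<N. c n * \<alpha> n) = S 0 - c N * S N" for N
  proof (induction N)
    case (Suc N)
    thus ?case
      using step[of N] by (simp add: c_Suc algebra_simps)
  qed (simp add: c_def)
  have "\<beta> \<longlonglongrightarrow> quad_factor1 p (0 * a) (0 * x) (0 * y) (0 * z) d"
    unfolding \<beta>_def quad_factor1_def using p p3 d
    by (intro tendsto_divide tendsto_mult tendsto_diff tendsto_minus tendsto_const LIMSEQ_power_zero) simp_all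
  hence "\<beta> \<longlonglongrightarrow> 0"
    by (simp add: quad_factor1_def)
  from tendstoD[OF this, of "1 / 2"]
  obtain N where N: "\<bar>\<beta> n\<bar> < 1 / 2" if "n \<ge> N" for n
    by (auto simp: eventually_sequentially)
  \<comment> \<open>Summability serves as a route to
    \<open>c \<longlonglongrightarrow> 0\<close>.\<close>
  have "summable c"
  proof (rule summable_ratio_test[of "1 / 2" N])
    fix n assume "N \<le> n"
    have "\<bar>\<beta> n\<bar> * \<bar>c n\<bar> \<le> 1 / 2 * \<bar>c n\<bar>"
      using N[OF \<open>N \<le> n\<close>] by (intro mult_right_mono) auto
    thus "norm (c (Suc n)) \<le> 1 / 2 * norm (c n)"
      by (simp add: c_Suc abs_mult mult_ac)
  qed simp
  hence c0: "c \<longlonglongrightarrow> 0"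
    by (rule summable_LIMSEQ_zero)
  have S_bound: "\<bar>S n\<bar> \<le> K" for n
  proof -
    have "norm (S n) \<le> K"
      unfolding S_def K_def using p in01[OF x] in01[OF y] in01[OF z] d an
      by (intro norm_suminf_le summable_quad_bound) (auto intro!: quad_term_bound(2) simp: less_imp_le)
    thus ?thesis
      by simp
  qed
  have "(\<lambda>N. c N * S N) \<longlonglongrightarrow> 0"
  proof (rule Lim_null_comparison)
    show "\<forall>\<^sub>F n in sequentially. norm (c n * S n) \<le> \<bar>c n\<bar> * K"
      using S_bound by (auto simp: abs_mult intro!: always_eventually mult_left_mono)
    show "(\<lambda>n. \<bar>c n\<bar> * K) \<longlonglongrightarrow> 0"
      using tendsto_mult_right[OF tendsto_rabs[OF c0], of K] by simp
  qed
  from tendsto_diff[OF tendsto_const[of "S 0"] this] have "(\<lambda>n. c n * \<alpha> n) sums S 0"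
    by (simp add: sums_def partial)
  thus ?thesis
    by (simp add: \<alpha>_def S_def)
qed

section \<open>Specialisation to p = t^3, a = x = y = d = t, z = t^2\<close>

text \<open>Here \<open>p * a / d\<close>, \<open>p^2 * a / d\<close>, \<open>p ^ 3 * a / d\<close>
  become three consecutive powers of \<open>p\<close>, which over all steps fill up
  \<open>qpoch p p (3 * n)\<close>. The factors \<open>- (p * a)\<close> give the sign and the power
  of \<open>t\<close>.\<close>

lemma prod_quad_factor1:
  fixes t :: real
  assumes t: "0 < t" "t < 1"
  defines "p \<equiv> t ^ 3"
  shows "(\<Prod>j<n. quad_factor1 p ((p ^ 3) ^ j * t) (p ^ j * t) (p ^ j * t) (p ^ j * t\<^sup>2) t)
    = (- 1) ^ n * t ^ (4 * n + 9 * (\<Sum>{..<n}))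
      * ((qpoch t p n)\<^sup>2 * qpoch (t\<^sup>2) p n * qpoch (t ^ 4) (t ^ 6) n * qpoch (t ^ 5) (t ^ 6) n)
      / ((qpoch (t ^ 6) (t ^ 6) n)\<^sup>2 * qpoch p p (3 * n))"
proof (induction n)
  case (Suc n)
  define A where "A = t ^ (3 * n)"
  \<comment> \<open>This factor occurs twice in the numerator of \<open>quad_factor1\<close> and
    once in its denominator; one copy cancels.\<close>
  have nz: "1 - t ^ 5 * A\<^sup>2 \<noteq> 0"
  proof -
    have "t ^ 5 * A\<^sup>2 = t ^ (5 + 6 * n)"
      by (simp add: A_def power_add power_mult [symmetric] mult_ac)
    also have "\<dots> < 1"
      using t by (simp add: power_less_one_iff del: power_add)
    finally show ?thesis
      by simp
  qed
  have pw: "p ^ n = A" "(p ^ 3) ^ n = A ^ 3" "(t ^ 6) ^ n = A\<^sup>2" "p ^ (3 * n) = A ^ 3"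
    by (simp_all add: A_def p_def power_mult [symmetric] mult.commute)
  have tri: "qpoch p p (3 * Suc n) = qpoch p p (3 * n)
      * ((1 - t ^ 3 * A ^ 3) * (1 - t ^ 6 * A ^ 3) * (1 - t ^ 9 * A ^ 3))"
  proof -
    have "3 * Suc n = Suc (Suc (Suc (3 * n)))"
      by simp
    thus ?thesis
      by (simp only: qpoch_Suc power_Suc pw) (simp add: p_def eval_nat_numeral mult_ac)
  qed
  have sg: "t ^ (4 * Suc n + 9 * (\<Sum>{..<Suc n})) = t ^ (4 * n + 9 * (\<Sum>{..<n})) * (t ^ 4 * A ^ 3)"
  proof -
    have "4 * Suc n + 9 * (\<Sum>{..<Suc n}) = 4 * n + 9 * (\<Sum>{..<n}) + (4 + 9 * n)"
      by simp
    moreover have "A ^ 3 = t ^ (9 * n)"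
      by (simp add: A_def power_mult [symmetric] mult.commute)
    ultimately show ?thesis
      by (simp only: power_add)
  qed
  have "quad_factor1 p (A ^ 3 * t) (A * t) (A * t) (A * t\<^sup>2) t =
     - (t ^ 4 * A ^ 3) * ((1 - t ^ 5 * A\<^sup>2) * (1 - t ^ 5 * A\<^sup>2) * (1 - t ^ 4 * A\<^sup>2))
      * ((1 - t * A) * (1 - t * A) * (1 - t\<^sup>2 * A))
      / ((1 - t ^ 6 * A\<^sup>2) * (1 - t ^ 6 * A\<^sup>2) * (1 - t ^ 5 * A\<^sup>2)
         * ((1 - t ^ 3 * A ^ 3) * (1 - t ^ 6 * A ^ 3) * (1 - t ^ 9 * A ^ 3)))"
    using t by (simp add: quad_factor1_def p_def eval_nat_numeral mult_ac)
  also have "\<dots> = - (t ^ 4 * A ^ 3) * ((1 - A\<^sup>2 * t ^ 5) * (1 - A\<^sup>2 * t ^ 4))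
      * ((1 - A * t)\<^sup>2 * (1 - A * t\<^sup>2))
      / ((1 - A\<^sup>2 * t ^ 6)\<^sup>2 * ((1 - t ^ 3 * A ^ 3) * (1 - t ^ 6 * A ^ 3) * (1 - t ^ 9 * A ^ 3)))"
    using nz by (simp add: power2_eq_square mult_ac)
  finally have factor: "quad_factor1 p (A ^ 3 * t) (A * t) (A * t) (A * t\<^sup>2) t = \<dots>" .
  have regroup: "s * T * (Q1\<^sup>2 * Q2 * Q3 * Q4) / (R\<^sup>2 * K) * (- u * (v5 * v4) * (v1\<^sup>2 * v2) / (w\<^sup>2 * k))
    = - 1 * s * (T * u) * ((Q1 * v1)\<^sup>2 * (Q2 * v2) * (Q3 * v4) * (Q4 * v5)) / ((R * w)\<^sup>2 * (K * k))"
    for s T Q1 Q2 Q3 Q4 R K u v1 v2 v4 v5 w k :: real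
    by (simp add: power_mult_distrib mult_ac)
  show ?case
    unfolding prod.lessThan_Suc Suc.IH pw factor tri sg qpoch_Suc power_Suc [of "- 1"]
    by (rule regroup)
qed simp

text \<open>Equates the braces of the theorem with alpha of relation (1), both cleared of
  denominators, where \<open>A = t ^ (3 * n)\<close>.\<close>

lemma brace_polynomial_identity:
  fixes t A :: real
  shows "A * t * (t - A\<^sup>2) * (1 - A ^ 3 * t ^ 3) * (1 - A\<^sup>2 * t ^ 4) + (1 - A ^ 4 * t ^ 4)\<^sup>2 * (1 - A * t\<^sup>2)
    = (1 - A ^ 3 * t) * (1 - A ^ 3 * t ^ 3) * (1 - A ^ 3 * t ^ 6) + A ^ 3 * t ^ 3 * (1 - A * t)\<^sup>2 * (1 - A * t\<^sup>2)"
  by algebra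

text \<open>Here \<open>y * z = t * t^2 = p\<close>, so the product evaluation applies. The products
  starting at \<open>t ^ 5\<close> above and below the fraction bar cancel, being nonzero.\<close>

lemma suminf_quad_term_cubic:
  fixes t :: real
  assumes t: "0 < t" "t < 1"
  shows "suminf (quad_term (t ^ 3) t t t (t\<^sup>2) t)
    = qpoch_inf t (t ^ 6) * (qpoch_inf (t ^ 4) (t ^ 6))\<^sup>2 / ((qpoch_inf (t ^ 6) (t ^ 6))\<^sup>2 * qpoch_inf (t ^ 3) (t ^ 6))"
proof -
  have lt: "t ^ n < 1" if "n > 0" for n
    using t that by (simp add: power_less_one_iff)
  have "qpoch_inf (t ^ 5) (t ^ 6) \<noteq> 0"
    using t lt by (intro qpoch_inf_nz) auto
  moreover have "(t ^ 3)\<^sup>2 = t ^ 6" "t ^ 3 * t = t ^ 4" "t ^ 4 * t\<^sup>2 = t ^ 6" "t ^ 4 * t = t ^ 5" "t * t\<^sup>2 = t ^ 3"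
    by (simp_all add: eval_nat_numeral)
  moreover have "t ^ 6 / t = t ^ 5" "t ^ 5 / t = t ^ 4" "t ^ 4 / t = t ^ 3" "t ^ 6 * t / t = t ^ 6"
    using t by (simp_all add: eval_nat_numeral)
  ultimately show ?thesis
    using suminf_quad_term[of "t ^ 3" t "t\<^sup>2" t t] t lt lt[of 2]
    by (simp add: power2_eq_square mult_ac)
qed

text \<open>The braces match alpha only together with pieces of the rest of the summand: the
  trinomial, \<open>A * t^2\<close> from the power of \<open>q\<close>, and
  \<open>1 - A^2 * t ^ 4\<close> from shifting the factorial of \<open>q powr (5/3)\<close>.\<close>

lemma brace_eq_quad_cert1:
  fixes t A :: real
  assumes t: "0 < t" "t < 1" and A: "0 < A" "A \<le> 1"
  shows "(1 - A\<^sup>2 * t ^ 4) / (1 + A * t\<^sup>2 + A\<^sup>2 * t ^ 4) * (A * t\<^sup>2)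
      * ((1 - A\<^sup>2 / t) / (1 - A * t\<^sup>2)
        + (1 - A ^ 4 * t ^ 4)\<^sup>2 / (A * t\<^sup>2 * ((1 - A\<^sup>2 * t ^ 4) * (1 - A ^ 3 * t ^ 3))))
    = - quad_cert1 (t ^ 3) (A ^ 3 * t) (A * t) (A * t) (A * t\<^sup>2) t 1"
proof -
  have lt: "A ^ m * t ^ n \<noteq> 1" if "n > 0" for m n
  proof -
    have "A ^ m * t ^ n \<le> 1 * t ^ n"
      using t A by (intro mult_right_mono power_le_one) auto
    also have "\<dots> < 1"
      using t that by (simp add: power_less_one_iff)
    finally show ?thesis
      by simp
  qed
  define u v w r where defs: "u = 1 - A * t\<^sup>2" "v = 1 - A\<^sup>2 * t ^ 4" "w = 1 - A ^ 3 * t ^ 3"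
    "r = 1 + A * t\<^sup>2 + A\<^sup>2 * t ^ 4"
  have nz: "u \<noteq> 0" "v \<noteq> 0" "w \<noteq> 0"
    using lt[of 2 1] lt[of 4 2] lt[of 3 3] by (auto simp: defs)
  \<comment> \<open>This factorisation accounts for the trinomial: the product is the denominator
    \<open>1 - p^2 * a / d\<close> of the certificate.\<close>
  have ru: "r * u = 1 - A ^ 3 * t ^ 6"
    unfolding defs by algebra
  hence r: "r \<noteq> 0"
    using lt[of 6 3] by auto
  have "v / r * (A * t\<^sup>2) * ((1 - A\<^sup>2 / t) / u + (1 - A ^ 4 * t ^ 4)\<^sup>2 / (A * t\<^sup>2 * (v * w)))
      = (A * t * (t - A\<^sup>2) * w * v + (1 - A ^ 4 * t ^ 4)\<^sup>2 * u) / (w * (r * u))"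
    using nz r t A by (simp add: field_simps power2_eq_square)
  also have "A * t * (t - A\<^sup>2) * w * v + (1 - A ^ 4 * t ^ 4)\<^sup>2 * u
      = (1 - A ^ 3 * t) * (w * (r * u)) + A ^ 3 * t ^ 3 * ((1 - A * t) * (1 - A * t) * u)"
    unfolding ru using brace_polynomial_identity[of A t] by (simp add: defs power2_eq_square mult_ac)
  also have "\<dots> / (w * (r * u)) = (1 - A ^ 3 * t) + A ^ 3 * t ^ 3 * ((1 - A * t) * (1 - A * t) * u) / (w * (r * u))"
    using nz r by (simp add: add_divide_distrib)
  also have "\<dots> = - quad_cert1 (t ^ 3) (A ^ 3 * t) (A * t) (A * t) (A * t\<^sup>2) t 1"
  proof -
    have "t ^ 3 * (A ^ 3 * t) / t = A ^ 3 * t ^ 3" "(t ^ 3)\<^sup>2 * (A ^ 3 * t) / t = A ^ 3 * t ^ 6"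
      using t by (simp_all flip: power_mult)
    thus ?thesis
      unfolding quad_cert1_def ru by (simp add: defs)
  qed
  finally show ?thesis
    by (simp add: defs)
qed

section \<open>Translation from powers of t to powers of q\<close>

theorem mainTheorem10:
  fixes q :: real
  assumes "0 < q" and "q < 1"
  shows "(\<lambda>n::nat.
      (-1) ^ n
      * (qpochs [q powr (1/6), q powr (1/6), q powr (1/3)] (q powr (1/2)) n
          * qpoch (q powr (5/3)) q n * qpoch (q powr (5/6)) q n
         / ((qpoch q q n)\<^sup>2 * qpoch (q powr (1/2)) (q powr (1/2)) (3 * n)
            * (1 + q powr (real n / 2 + 1/3) + q powr (real n + 2/3))))
      * q powr ((9 * (real n)\<^sup>2 + 5 * real n + 4) / 12)
      * ((1 - q powr (real n - 1/6)) / (1 - q powr (real n / 2 + 1/3))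
         + q powr (- (real n / 2) - 1/3) * (1 - q powr (2 * real n + 2/3))\<^sup>2
           / ((1 - q powr (real n + 2/3)) * (1 - q powr (3 * real n / 2 + 1/2)))))
    sums
      (qpoch_inf (q powr (2/3)) q * qpoch_inf (q powr (5/3)) q * qpoch_inf (q powr (1/6)) q
        / ((qpoch_inf q q)\<^sup>2 * qpoch_inf (q powr (1/2)) q))"
    (is "?T sums ?L")
proof -
  define t where "t = q powr (1 / 6)"
  have t: "0 < t" "t < 1"
    using assms powr_less_mono2[of "1 / 6" q 1] by (auto simp: t_def)
  have qt: "q powr r = t ^ m" if "r = real m / 6" for r m
    unfolding that using assms by (simp add: t_def powr_powr flip: powr_realpow)
  have q: "q = t ^ 6"
    using qt[of 1 6] assms by simp
  have t01: "t ^ m < 1" if "m > 0" for m :: nat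
    using t that by (simp add: power_less_one_iff)
  have powr_consts: "q powr (1/6) = t" "q powr (1/3) = t\<^sup>2" "q powr (1/2) = t ^ 3"
    "q powr (5/3) = t ^ 10" "q powr (5/6) = t ^ 5" "q powr (2/3) = t ^ 4"
    using qt[of "1/6" 1] qt[of "1/3" 2] qt[of "1/2" 3] qt[of "5/3" 10] qt[of "5/6" 5] qt[of "2/3" 4]
    by simp_all
  define c where "c n = (\<Prod>j<n. quad_factor1 (t ^ 3) (((t ^ 3) ^ 3) ^ j * t) ((t ^ 3) ^ j * t) ((t ^ 3) ^ j * t)
      ((t ^ 3) ^ j * t\<^sup>2) t)" for n
  define \<alpha> where "\<alpha> n = - quad_cert1 (t ^ 3) (((t ^ 3) ^ 3) ^ n * t) ((t ^ 3) ^ n * t) ((t ^ 3) ^ n * t)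
      ((t ^ 3) ^ n * t\<^sup>2) t 1" for n
  have T: "?T n = c n * \<alpha> n / (1 - t ^ 4)" for n
  proof -
    define A where "A = t ^ (3 * n)"
    have A: "0 < A" "A \<le> 1"
      using t by (auto simp: A_def power_le_one)
    \<comment> \<open>The exponents below are written as \<open>3 * n * j + i\<close>, even for
      \<open>j = 1\<close> or \<open>i = 0\<close>, to match this rule.\<close>
    have tn: "t ^ (3 * n * j + i) = A ^ j * t ^ i" for i j
      by (simp add: A_def power_add power_mult)
    have "real (\<Sum>{..<n}) = real n * (real n - 1) / 2"
      by (induction n) (auto simp: field_simps)
    \<comment> \<open>Six times the exponent splits into the part
      \<open>4 * n + 9 * (\<Sum>{..<n})\<close> from \<open>prod_quad_factor1\<close> and
      \<open>3 * n + 2\<close>, which is \<open>A * t^2\<close>.\<close>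
    hence e: "q powr ((9 * (real n)\<^sup>2 + 5 * real n + 4) / 12) = t ^ (4 * n + 9 * (\<Sum>{..<n}) + (3 * n * 1 + 2))"
      by (intro qt) (simp add: field_simps power2_eq_square)
    have e: "q powr ((9 * (real n)\<^sup>2 + 5 * real n + 4) / 12) = t ^ (4 * n + 9 * (\<Sum>{..<n})) * (A * t\<^sup>2)"
      unfolding e power_add[of t "4 * n + 9 * (\<Sum>{..<n})"] tn by simp
    have "q powr (real n / 2 + 1/3) = t ^ (3 * n * 1 + 2)" "q powr (real n + 2/3) = t ^ (3 * n * 2 + 4)"
      "q powr (2 * real n + 2/3) = t ^ (3 * n * 4 + 4)" "q powr (3 * real n / 2 + 1/2) = t ^ (3 * n * 3 + 3)"
      "q powr (real n) = t ^ (3 * n * 2 + 0)"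
      by (rule qt, simp add: field_simps)+
    hence pws: "q powr (real n / 2 + 1/3) = A * t\<^sup>2" "q powr (real n + 2/3) = A\<^sup>2 * t ^ 4"
      "q powr (2 * real n + 2/3) = A ^ 4 * t ^ 4" "q powr (3 * real n / 2 + 1/2) = A ^ 3 * t ^ 3"
      "q powr (real n) = A\<^sup>2"
      unfolding tn by simp_all
    \<comment> \<open>These two exponents can be negative, so they are handled as quotients instead
      of natural powers of \<open>t\<close>.\<close>
    have "q powr (real n - 1/6) = q powr (real n) / q powr (1/6)"
      by (rule powr_diff)
    hence m1: "q powr (real n - 1/6) = A\<^sup>2 / t"
      unfolding pws powr_consts .
    have "q powr (- (real n / 2) - 1/3) = q powr (- (real n / 2 + 1/3))"
      by simp
    hence m2: "q powr (- (real n / 2) - 1/3) = 1 / (A * t\<^sup>2)"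
      unfolding powr_minus_divide pws .
    have \<alpha>: "\<alpha> n = (1 - A\<^sup>2 * t ^ 4) / (1 + A * t\<^sup>2 + A\<^sup>2 * t ^ 4) * (A * t\<^sup>2)
      * ((1 - A\<^sup>2 / t) / (1 - A * t\<^sup>2)
        + (1 - A ^ 4 * t ^ 4)\<^sup>2 / (A * t\<^sup>2 * ((1 - A\<^sup>2 * t ^ 4) * (1 - A ^ 3 * t ^ 3))))"
    proof -
      have "(t ^ 3) ^ n = A" "((t ^ 3) ^ 3) ^ n = A ^ 3"
        by (simp_all add: A_def power_mult [symmetric] mult.commute)
      thus ?thesis
        unfolding brace_eq_quad_cert1[OF t A] \<alpha>_def by simp
    qed
    \<comment> \<open>The theorem has \<open>t ^ 10\<close> where \<open>prod_quad_factor1\<close>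
      has \<open>t ^ 4\<close>; the shift is the source of the constant
      \<open>1 - t ^ 4\<close>.\<close>
    have shift: "qpoch (t ^ 10) (t ^ 6) n = qpoch (t ^ 4) (t ^ 6) n * (1 - A\<^sup>2 * t ^ 4) / (1 - t ^ 4)"
    proof -
      have "(t ^ 6) ^ n = A\<^sup>2"
        by (simp add: A_def power_mult [symmetric] mult.commute)
      moreover have "t ^ 6 * t ^ 4 = t ^ 10"
        by (simp flip: power_add)
      ultimately show ?thesis
        using qpoch_shift[of "t ^ 4" "t ^ 6" n] t01[of 4] by (simp add: nonzero_eq_divide_eq mult_ac)
    qed
    have regroup: "s * (Q1 * (Q1 * (Q2 * 1)) * (Q3 * v / f) * Q4 / (R * K * r)) * (T * h) * (X + 1 / h * Y / (v * w))
      = s * T * (Q1\<^sup>2 * Q2 * Q3 * Q4) / (R * K) * (v / r * h * (X + Y / (h * (v * w)))) / f"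
      for s Q1 Q2 Q3 Q4 v f R K r T h X Y w :: real
      by (simp add: power2_eq_square mult_ac)
    show ?thesis
      unfolding powr_consts e pws m1 m2 \<alpha> c_def prod_quad_factor1[OF t] qpochs_def
        list.map prod_list.Cons prod_list.Nil q [symmetric]
      unfolding q shift by (rule regroup)
  qed
  have "(\<lambda>n. c n * \<alpha> n) sums suminf (quad_term (t ^ 3) t t t (t\<^sup>2) t)"
  proof -
    have balanced: "t ^ 3 * t = t * t * t\<^sup>2"
      by (simp add: eval_nat_numeral)
    show ?thesis
      unfolding c_def \<alpha>_def by (intro quad_term_accelerated balanced) (use t t01 in auto)
  qed
  hence "?T sums (suminf (quad_term (t ^ 3) t t t (t\<^sup>2) t) / (1 - t ^ 4))"
    unfolding T by (rule sums_divide)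
  also have "suminf (quad_term (t ^ 3) t t t (t\<^sup>2) t) / (1 - t ^ 4) = ?L"
  proof -
    \<comment> \<open>Letting \<open>n\<close> tend to infinity in \<open>qpoch_shift\<close> gives
      the same shift for the infinite products, so the left-hand side absorbs the same
      constant.\<close>
    have "(\<lambda>n. (1 - t ^ 4) * qpoch (t ^ 6 * t ^ 4) (t ^ 6) n)
        \<longlonglongrightarrow> (1 - t ^ 4) * qpoch_inf (t ^ 6 * t ^ 4) (t ^ 6)"
      using t t01[of 6] by (intro tendsto_mult tendsto_const qpoch_LIMSEQ) auto
    moreover have "(\<lambda>n. qpoch (t ^ 4) (t ^ 6) n * (1 - (t ^ 6) ^ n * t ^ 4))
        \<longlonglongrightarrow> qpoch_inf (t ^ 4) (t ^ 6) * (1 - 0 * t ^ 4)"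
      using t t01[of 6] by (intro tendsto_mult tendsto_diff tendsto_const qpoch_LIMSEQ LIMSEQ_power_zero) auto
    ultimately have "(1 - t ^ 4) * qpoch_inf (t ^ 6 * t ^ 4) (t ^ 6) = qpoch_inf (t ^ 4) (t ^ 6)"
      unfolding qpoch_shift using LIMSEQ_unique by fastforce
    hence absorb: "qpoch_inf (t ^ 10) (t ^ 6) = qpoch_inf (t ^ 4) (t ^ 6) / (1 - t ^ 4)"
      using t01[of 4] by (simp add: nonzero_eq_divide_eq mult_ac flip: power_add)
    show ?thesis
      unfolding suminf_quad_term_cubic[OF t] powr_consts unfolding q absorb
      by (simp add: power2_eq_square mult_ac)
  qed
  finally show ?thesis .
qed

end
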